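(* Let $g\in L^\infty(\mathcal X)$ and let $\widehat g$ be the multiplication operator on $\mathcal H$, $\widehat g f=gf$. Then $\|\widehat g\|_\mu=\|g\|$, where $\|g\|=\big(\int_{\mathcal X}|g|^2\,d\mu\big)^{1/2}$ is the $L^2$-norm of $g$.
   Context: $(\mathcal X,\mathcal B,\mu)$ is a probability measure space and $\mathcal H=L^2(\mathcal X,\mu)$ (complex-valued). For $X\in\mathcal B$, $\pi_X:\mathcal H\to\mathcal H$ is the orthogonal projector $\pi_Xf=\mathbf 1_X f$. A partition is a finite family $\chi=\{Y_1,\dots,Y_J\}\subset\mathcal B$ with $\mu(\mathcal X\setminus\bigcup_j Y_j)=0$ and $\mu(Y_j\cap Y_k)=0$ for $j\ne k$. For a bounded operator $W$ on $\mathcal H$ with operator norm $\|W\|$, put $\mathcal M_\chi(W)=\sum_{j=1}^J\mu(Y_j)\|W\pi_{Y_j}\|^2$, and define the $\mu$-norm $\|W\|_\mu=\inf_\chi\sqrt{\mathcal M_\chi(W)}$, the infimum being over all partitions $\chi$. *)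

theory Defs
  imports "HOL-Probability.Probability"
begin

text \<open>
  Elements of \<open>L\<^sup>2\<close> and \<open>L\<^sup>\<infinity>\<close> are given by representatives: functions \<open>'a \<Rightarrow> complex\<close>, where two
  functions that agree almost everywhere stand for the same element. Accordingly an operator on
  \<open>L\<^sup>2\<close> is a map on representatives that respects almost-everywhere equality.
\<close>

definition L2 :: "'a measure \<Rightarrow> ('a \<Rightarrow> complex) set" where
  "L2 M = {f \<in> borel_measurable M. integrable M (\<lambda>x. (cmod (f x))\<^sup>2)}"

definition L2_norm :: "'a measure \<Rightarrow> ('a \<Rightarrow> complex) \<Rightarrow> real" where
  "L2_norm M f = sqrt (\<integral>x. (cmod (f x))\<^sup>2 \<partial>M)"

definition L_infty :: "'a measure \<Rightarrow> ('a \<Rightarrow> complex) set" where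
  "L_infty M = {g \<in> borel_measurable M. \<exists>C. AE x in M. cmod (g x) \<le> C}"

definition bounded_operator ::
  "'a measure \<Rightarrow> (('a \<Rightarrow> complex) \<Rightarrow> 'a \<Rightarrow> complex) \<Rightarrow> bool" where
  "bounded_operator M W \<longleftrightarrow>
     (\<forall>f\<in>L2 M. W f \<in> L2 M) \<and>
     (\<forall>f\<in>L2 M. \<forall>h\<in>L2 M. (AE x in M. f x = h x) \<longrightarrow> (AE x in M. W f x = W h x)) \<and>
     (\<forall>f\<in>L2 M. \<forall>h\<in>L2 M. AE x in M. W (\<lambda>y. f y + h y) x = W f x + W h x) \<and>
     (\<forall>c. \<forall>f\<in>L2 M. AE x in M. W (\<lambda>y. c * f y) x = c * W f x) \<and>
     (\<exists>C. \<forall>f\<in>L2 M. L2_norm M (W f) \<le> C * L2_norm M f)"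

text \<open>
  The supremum is taken in \<^typ>\<open>real\<close>, so \<open>op_norm\<close> and everything built on it is meaningful
  only for operators satisfying \<open>bounded_operator\<close>; see \<open>bounded_operator_mult_op\<close> and
  \<open>bounded_operator_proj_op\<close> below.
\<close>

definition op_norm ::
  "'a measure \<Rightarrow> (('a \<Rightarrow> complex) \<Rightarrow> 'a \<Rightarrow> complex) \<Rightarrow> real" where
  "op_norm M W = Sup {L2_norm M (W f) | f. f \<in> L2 M \<and> L2_norm M f \<le> 1}"

definition proj_op :: "'a set \<Rightarrow> ('a \<Rightarrow> complex) \<Rightarrow> 'a \<Rightarrow> complex" where
  "proj_op Y f = (\<lambda>x. indicator Y x * f x)"

definition mult_op :: "('a \<Rightarrow> complex) \<Rightarrow> ('a \<Rightarrow> complex) \<Rightarrow> 'a \<Rightarrow> complex" where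
  "mult_op g f = (\<lambda>x. g x * f x)"

text \<open>
  A partition is an indexed family \<open>Y 1, \<dots>, Y J\<close>; the same (null) set may occur under several
  indices. The values of \<open>Y\<close> outside \<open>{1..J}\<close> are irrelevant.
\<close>

definition ae_partition :: "'a measure \<Rightarrow> nat \<Rightarrow> (nat \<Rightarrow> 'a set) \<Rightarrow> bool" where
  "ae_partition M J Y \<longleftrightarrow>
     (\<forall>j\<in>{1..J}. Y j \<in> sets M) \<and>
     measure M (space M - (\<Union>j\<in>{1..J}. Y j)) = 0 \<and>
     (\<forall>j\<in>{1..J}. \<forall>k\<in>{1..J}. j \<noteq> k \<longrightarrow> measure M (Y j \<inter> Y k) = 0)"

definition M_part ::
  "'a measure \<Rightarrow> nat \<Rightarrow> (nat \<Rightarrow> 'a set) \<Rightarrow> (('a \<Rightarrow> complex) \<Rightarrow> 'a \<Rightarrow> complex) \<Rightarrow> real" where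
  "M_part M J Y W = (\<Sum>j=1..J. measure M (Y j) * (op_norm M (W \<circ> proj_op (Y j)))\<^sup>2)"

definition mu_norm ::
  "'a measure \<Rightarrow> (('a \<Rightarrow> complex) \<Rightarrow> 'a \<Rightarrow> complex) \<Rightarrow> real" where
  "mu_norm M W = Inf {sqrt (M_part M J Y W) | J Y. ae_partition M J Y}"

lemma bounded_operator_mult_op:
  assumes "g \<in> L_infty M"
  shows "bounded_operator M (mult_op g)"
proof -
  from assms obtain C0 where g [measurable]: "g \<in> borel_measurable M"
    and C0: "AE x in M. cmod (g x) \<le> C0"
    by (auto simp: L_infty_def)
  define C where "C = max C0 0"
  have C: "C \<ge> 0" "AE x in M. cmod (g x) \<le> C"
    using C0 by (auto simp: C_def elim: eventually_mono)
  have le: "AE x in M. (cmod (g x * f x))\<^sup>2 \<le> C\<^sup>2 * (cmod (f x))\<^sup>2" for f :: "'a \<Rightarrow> complex"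
    using C(2)
  proof eventually_elim
    case (elim x)
    then have "cmod (g x) * cmod (f x) \<le> C * cmod (f x)"
      by (intro mult_right_mono) auto
    then have "(cmod (g x) * cmod (f x))\<^sup>2 \<le> (C * cmod (f x))\<^sup>2"
      by (intro power_mono) auto
    then show ?case by (simp add: norm_mult power_mult_distrib)
  qed
  have int: "integrable M (\<lambda>x. (cmod (g x * f x))\<^sup>2)" if "f \<in> L2 M" for f
  proof -
    from that have [measurable]: "f \<in> borel_measurable M"
      and i: "integrable M (\<lambda>x. (cmod (f x))\<^sup>2)" by (auto simp: L2_def)
    show ?thesis
      by (rule Bochner_Integration.integrable_bound[where f = "\<lambda>x. C\<^sup>2 * (cmod (f x))\<^sup>2"])
         (use i le[of f] in auto)
  qed
  have bd: "L2_norm M (mult_op g f) \<le> C * L2_norm M f" if f: "f \<in> L2 M" for f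
  proof -
    have i: "integrable M (\<lambda>x. (cmod (f x))\<^sup>2)" using f by (auto simp: L2_def)
    have "(\<integral>x. (cmod (g x * f x))\<^sup>2 \<partial>M) \<le> (\<integral>x. C\<^sup>2 * (cmod (f x))\<^sup>2 \<partial>M)"
      by (rule integral_mono_AE) (use i int[OF f] le[of f] in auto)
    also have "\<dots> = C\<^sup>2 * (\<integral>x. (cmod (f x))\<^sup>2 \<partial>M)" by simp
    finally have "sqrt (\<integral>x. (cmod (g x * f x))\<^sup>2 \<partial>M) \<le> sqrt (C\<^sup>2 * (\<integral>x. (cmod (f x))\<^sup>2 \<partial>M))"
      by (rule real_sqrt_le_mono)
    then show ?thesis using C(1) by (simp add: L2_norm_def mult_op_def real_sqrt_mult)
  qed
  have "mult_op g f \<in> L2 M" if "f \<in> L2 M" for f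
    using that int[OF that] by (auto simp: L2_def mult_op_def)
  moreover have "AE x in M. mult_op g f x = mult_op g h x" if "AE x in M. f x = h x" for f h
    using that by eventually_elim (simp add: mult_op_def)
  ultimately show ?thesis
    unfolding bounded_operator_def using bd
    by (auto simp: mult_op_def algebra_simps intro!: exI[of _ C])
qed

lemma bounded_operator_proj_op:
  assumes "Y \<in> sets M"
  shows "bounded_operator M (proj_op Y)"
proof -
  have "indicator Y \<in> L_infty M"
    using assms by (auto simp: L_infty_def indicator_def intro!: exI[of _ 1])
  moreover have "proj_op Y = mult_op (indicator Y)"
    by (simp add: fun_eq_iff proj_op_def mult_op_def)
  ultimately show ?thesis by (simp add: bounded_operator_mult_op)
qed

end

theory Submission
  imports Defs
begin

text \<open>
  Testing \<open>g \<pi>\<^sub>Y\<close> on the normalised indicator of \<open>Y\<close> gives \<open>\<mu>(Y) \<parallel>g \<pi>\<^sub>Y\<parallel>\<^sup>2 \<ge> \<integral>\<^sub>Y |g|\<^sup>2\<close>, so every partition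
  dominates \<open>\<parallel>g\<parallel>\<^sup>2\<close>. Conversely, if \<open>|g|\<^sup>2\<close> oscillates by at most \<open>\<epsilon>\<close> on each piece, as it does on the
  pieces \<open>(j - 1) \<epsilon> \<le> |g|\<^sup>2 < j \<epsilon>\<close>, then \<open>\<parallel>g \<pi>\<^sub>Y\<parallel>\<^sup>2 \<le> sup\<^sub>Y |g|\<^sup>2\<close> exceeds \<open>|g|\<^sup>2\<close> by at most \<open>\<epsilon>\<close> on \<open>Y\<close>.
\<close>

text \<open>The projection kills \<open>f\<close> outside \<open>Y\<close>, so a bound on |g| over
  \<open>Y\<close> alone dominates the integrand everywhere.\<close>

lemma L2_norm_mult_proj_le:
  assumes Y: "Y \<in> sets M" and c: "c \<ge> 0"
    and le: "AE x in M. x \<in> Y \<longrightarrow> cmod (g x) \<le> c" and f: "f \<in> L2 M"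
  shows "L2_norm M ((mult_op g \<circ> proj_op Y) f) \<le> c * L2_norm M f"
proof -
  have int: "integrable M (\<lambda>x. (cmod (f x))\<^sup>2)"
    using f by (simp add: L2_def)
  have "(\<integral>x. (cmod ((mult_op g \<circ> proj_op Y) f x))\<^sup>2 \<partial>M) \<le> (\<integral>x. c\<^sup>2 * (cmod (f x))\<^sup>2 \<partial>M)"
  proof (rule integral_mono_AE')
    show "AE x in M. (cmod ((mult_op g \<circ> proj_op Y) f x))\<^sup>2 \<le> c\<^sup>2 * (cmod (f x))\<^sup>2"
      using le
    proof eventually_elim
      case (elim x)
      then show ?case
        by (auto simp: mult_op_def proj_op_def norm_mult power_mult_distrib indicator_def
            intro!: mult_right_mono power_mono)
    qed
  qed (use int in auto)
  then have "sqrt (\<integral>x. (cmod ((mult_op g \<circ> proj_op Y) f x))\<^sup>2 \<partial>M)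
      \<le> sqrt (c\<^sup>2 * (\<integral>x. (cmod (f x))\<^sup>2 \<partial>M))"
    by (intro real_sqrt_le_mono) simp
  then show ?thesis
    using c by (simp add: L2_norm_def real_sqrt_mult)
qed

lemma L2_norm_mult_proj_le_const:
  assumes "Y \<in> sets M" and "c \<ge> 0" and "AE x in M. x \<in> Y \<longrightarrow> cmod (g x) \<le> c"
    and "f \<in> L2 M" and "L2_norm M f \<le> 1"
  shows "L2_norm M ((mult_op g \<circ> proj_op Y) f) \<le> c"
  using L2_norm_mult_proj_le[OF assms(1-4)] mult_left_mono[OF assms(5,2)] by simp

lemma op_norm_mult_proj_le:
  assumes "Y \<in> sets M" and "c \<ge> 0" and "AE x in M. x \<in> Y \<longrightarrow> cmod (g x) \<le> c"
  shows "op_norm M (mult_op g \<circ> proj_op Y) \<le> c"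
  unfolding op_norm_def
proof (rule cSup_least)
  \<comment> \<open>A least-upper-bound argument for the real \<open>Sup\<close> needs some
    admissible test function; zero serves.\<close>
  have "(\<lambda>x. 0) \<in> L2 M" "L2_norm M (\<lambda>x. 0) \<le> 1"
    by (simp_all add: L2_def L2_norm_def)
  then show "{L2_norm M ((mult_op g \<circ> proj_op Y) f) |f. f \<in> L2 M \<and> L2_norm M f \<le> 1} \<noteq> {}"
    by blast
qed (use L2_norm_mult_proj_le_const[OF assms] in auto)

lemma L_inftyE:
  assumes "g \<in> L_infty M"
  obtains C where "g \<in> borel_measurable M" "C \<ge> 0" "AE x in M. cmod (g x) \<le> C"
proof -
  from assms obtain C where "g \<in> borel_measurable M" "AE x in M. cmod (g x) \<le> C"
    by (auto simp: L_infty_def)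
  then show ?thesis
    by (intro that[of "max C 0"]) (auto elim: eventually_mono)
qed

text \<open>Essential boundedness of \<open>g\<close> makes the set of test values bounded above, so
  that the real-valued \<open>Sup\<close> really is an upper bound.\<close>

lemma L2_norm_le_op_norm_mult_proj:
  assumes g: "g \<in> L_infty M" and Y: "Y \<in> sets M" and f: "f \<in> L2 M" "L2_norm M f \<le> 1"
  shows "L2_norm M ((mult_op g \<circ> proj_op Y) f) \<le> op_norm M (mult_op g \<circ> proj_op Y)"
  unfolding op_norm_def
proof (rule cSup_upper)
  obtain C where C: "C \<ge> 0" "AE x in M. cmod (g x) \<le> C"
    using g by (rule L_inftyE)
  from C(2) have "AE x in M. x \<in> Y \<longrightarrow> cmod (g x) \<le> C"
    by eventually_elim simp
  from L2_norm_mult_proj_le_const[OF Y C(1) this]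
  show "bdd_above {L2_norm M ((mult_op g \<circ> proj_op Y) f) |f. f \<in> L2 M \<and> L2_norm M f \<le> 1}"
    by (auto simp: bdd_above_def)
qed (use f in blast)

context prob_space
begin

lemma integrable_L_infty_power2:
  assumes "g \<in> L_infty M"
  shows "integrable M (\<lambda>x. (cmod (g x))\<^sup>2)"
proof -
  obtain C where C: "g \<in> borel_measurable M" "C \<ge> 0" "AE x in M. cmod (g x) \<le> C"
    using assms by (rule L_inftyE)
  from C(3) have "AE x in M. norm ((cmod (g x))\<^sup>2) \<le> C\<^sup>2"
    by eventually_elim (auto intro: power_mono)
  with C(1) show ?thesis
    by (intro integrable_const_bound[where B = "C\<^sup>2"]) auto
qed

lemma set_integral_le_op_norm_mult_proj:
  assumes g: "g \<in> L_infty M" and Y [measurable]: "Y \<in> sets M"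
  shows "(\<integral>x. indicator Y x * (cmod (g x))\<^sup>2 \<partial>M)
    \<le> prob Y * (op_norm M (mult_op g \<circ> proj_op Y))\<^sup>2"
\<comment> \<open>The indicator of a null set cannot be normalised, but then both sides
  vanish.\<close>
proof (cases "prob Y = 0")
  case True
  then have "AE x in M. x \<notin> Y"
    using prob_eq_0[OF Y] by simp
  then have "AE x in M. indicator Y x * (cmod (g x))\<^sup>2 = 0"
    by eventually_elim simp
  then have "(\<integral>x. indicator Y x * (cmod (g x))\<^sup>2 \<partial>M) = 0"
    by (rule integral_eq_zero_AE)
  with True show ?thesis by simp
next
  case False
  then have pos: "prob Y > 0"
    by (simp add: zero_less_measure_iff)
  \<comment> \<open>Dividing by \<open>sqrt (prob Y)\<close> makes the integral of |f|^2 equal to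
    1.\<close>
  define f where "f = (\<lambda>x. complex_of_real (indicator Y x / sqrt (prob Y)))"
  have f_sq: "(cmod (f x))\<^sup>2 = indicator Y x / prob Y" for x
    using pos by (auto simp: f_def norm_divide power_divide indicator_def)
  have [measurable]: "f \<in> borel_measurable M"
    by (simp add: f_def)
  have "f \<in> L2 M"
    by (simp add: L2_def f_sq less_top[symmetric])
  moreover have "L2_norm M f \<le> 1"
    using pos by (simp add: L2_norm_def f_sq)
  ultimately have "L2_norm M ((mult_op g \<circ> proj_op Y) f) \<le> op_norm M (mult_op g \<circ> proj_op Y)"
    by (rule L2_norm_le_op_norm_mult_proj[OF g Y])
  then have "(L2_norm M ((mult_op g \<circ> proj_op Y) f))\<^sup>2 \<le> (op_norm M (mult_op g \<circ> proj_op Y))\<^sup>2"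
    by (rule power_mono) (simp add: L2_norm_def)
  moreover have "(cmod ((mult_op g \<circ> proj_op Y) f x))\<^sup>2
      = indicator Y x * (cmod (g x))\<^sup>2 / prob Y" for x
    by (auto simp: mult_op_def proj_op_def norm_mult power_mult_distrib f_sq indicator_def)
  then have "(L2_norm M ((mult_op g \<circ> proj_op Y) f))\<^sup>2
      = (\<integral>x. indicator Y x * (cmod (g x))\<^sup>2 \<partial>M) / prob Y"
    by (simp add: L2_norm_def del: o_apply)
  ultimately show ?thesis
    using pos by (simp add: pos_divide_le_eq mult.commute del: o_apply)
qed

text \<open>Almost every point lies in some piece, so |g|^2 is at most the sum of its restrictions
  to the pieces; the previous bound applies to each summand after integration.\<close>

lemma L2_norm_power2_le_M_part:
  assumes g: "g \<in> L_infty M" and part: "ae_partition M J Y"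
  shows "(L2_norm M g)\<^sup>2 \<le> M_part M J Y (mult_op g)"
proof -
  have Y: "Y j \<in> sets M" if "j \<in> {1..J}" for j
    using part that by (auto simp: ae_partition_def)
  have U: "(\<Union>j\<in>{1..J}. Y j) \<in> events"
    using Y by blast
  have cover: "AE x in M. x \<in> (\<Union>j\<in>{1..J}. Y j)"
    using part prob_compl[OF U] prob_eq_1[OF U] by (simp add: ae_partition_def)
  have int: "integrable M (\<lambda>x. indicator (Y j) x * (cmod (g x))\<^sup>2)" if "j \<in> {1..J}" for j
    using integrable_mult_indicator[OF Y[OF that] integrable_L_infty_power2[OF g]] by simp
  have "(L2_norm M g)\<^sup>2 = (\<integral>x. (cmod (g x))\<^sup>2 \<partial>M)"
    by (simp add: L2_norm_def)
  also have "\<dots> \<le> (\<integral>x. (\<Sum>j=1..J. indicator (Y j) x * (cmod (g x))\<^sup>2) \<partial>M)"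
  proof (rule integral_mono_AE')
    show "AE x in M. (cmod (g x))\<^sup>2 \<le> (\<Sum>j=1..J. indicator (Y j) x * (cmod (g x))\<^sup>2)"
      using cover
    proof eventually_elim
      case (elim x)
      then obtain k where k: "k \<in> {1..J}" "x \<in> Y k" by blast
      have "indicator (Y k) x * (cmod (g x))\<^sup>2 \<le> (\<Sum>j=1..J. indicator (Y j) x * (cmod (g x))\<^sup>2)"
        by (rule member_le_sum) (use k in auto)
      with k show ?case by simp
    qed
    show "integrable M (\<lambda>x. \<Sum>j=1..J. indicator (Y j) x * (cmod (g x))\<^sup>2)"
      by (rule Bochner_Integration.integrable_sum) (rule int)
  qed (auto intro: sum_nonneg)
  also have "\<dots> = (\<Sum>j=1..J. \<integral>x. indicator (Y j) x * (cmod (g x))\<^sup>2 \<partial>M)"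
    by (rule Bochner_Integration.integral_sum) (rule int)
  also have "\<dots> \<le> M_part M J Y (mult_op g)"
    unfolding M_part_def by (intro sum_mono set_integral_le_op_norm_mult_proj g Y)
  finally show ?thesis .
qed

text \<open>The pieces are the level sets of |g|^2 cut at multiples of \<open>e\<close>. The
  resulting bound on \<open>M_part\<close> is the integral of a step function lying at most
  \<open>e\<close> above |g|^2.\<close>

lemma ex_ae_partition_M_part_le:
  assumes g: "g \<in> L_infty M" and e: "e > 0"
  shows "\<exists>J Y. ae_partition M J Y \<and> M_part M J Y (mult_op g) \<le> (L2_norm M g)\<^sup>2 + e"
proof -
  obtain C where gM [measurable]: "g \<in> borel_measurable M"
    and C: "C \<ge> 0" "AE x in M. cmod (g x) \<le> C"
    using g by (rule L_inftyE)
  \<comment> \<open>The shift by 1 starts the indices at 1 and makes \<open>j * e\<close> the upper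
    end of the range of |g|^2 on piece \<open>j\<close>.\<close>
  define level where "level x = nat \<lfloor>(cmod (g x))\<^sup>2 / e\<rfloor> + 1" for x
  define Y where "Y j = {x \<in> space M. level x = j}" for j
  \<comment> \<open>The level that the value \<open>C\<close> would have: almost every point has
    level at most \<open>J\<close>.\<close>
  define J where "J = nat \<lfloor>C\<^sup>2 / e\<rfloor> + 1"
  have [measurable]: "level \<in> measurable M (count_space UNIV)"
    unfolding level_def by measurable
  have Y [measurable]: "Y j \<in> sets M" for j
    unfolding Y_def by measurable
  have level_lower: "(cmod (g x))\<^sup>2 \<le> real (level x) * e" for x
  proof -
    have "(cmod (g x))\<^sup>2 / e \<le> real (level x)"
      unfolding level_def by linarith
    with e show ?thesis by (simp add: field_simps)
  qed
  have level_upper: "real (level x) * e \<le> (cmod (g x))\<^sup>2 + e" for x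
  proof -
    have "0 \<le> (cmod (g x))\<^sup>2 / e"
      using e by simp
    then have "real (level x) \<le> (cmod (g x))\<^sup>2 / e + 1"
      unfolding level_def by linarith
    with e show ?thesis by (simp add: field_simps)
  qed
  have "AE x in M. x \<in> (\<Union>j\<in>{1..J}. Y j)"
    using C(2) AE_space
  proof eventually_elim
    case (elim x)
    then have "(cmod (g x))\<^sup>2 / e \<le> C\<^sup>2 / e"
      using e by (intro divide_right_mono power_mono) auto
    then have "level x \<in> {1..J}"
      unfolding level_def J_def by (auto intro: nat_mono floor_mono)
    with elim show ?case by (auto simp: Y_def)
  qed
  then have "prob (\<Union>j\<in>{1..J}. Y j) = 1"
    by (subst prob_eq_1) auto
  then have "prob (space M - (\<Union>j\<in>{1..J}. Y j)) = 0"
    by (subst prob_compl) auto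
  moreover have "Y j \<inter> Y k = {}" if "j \<noteq> k" for j k
    using that by (auto simp: Y_def)
  ultimately have part: "ae_partition M J Y"
    by (simp add: ae_partition_def)
  have op: "(op_norm M (mult_op g \<circ> proj_op (Y j)))\<^sup>2 \<le> real j * e" for j
  proof -
    have "op_norm M (mult_op g \<circ> proj_op (Y j)) \<le> sqrt (real j * e)"
    proof (rule op_norm_mult_proj_le)
      show "AE x in M. x \<in> Y j \<longrightarrow> cmod (g x) \<le> sqrt (real j * e)"
        using level_lower by (intro AE_I2) (auto simp: Y_def intro: real_le_rsqrt)
    qed (use e in auto)
    \<comment> \<open>Squaring preserves the inequality only for nonnegative quantities; testing on
      zero gives the sign.\<close>
    moreover have "0 \<le> op_norm M (mult_op g \<circ> proj_op (Y j))"
      using L2_norm_le_op_norm_mult_proj[OF g Y[of j], of "\<lambda>x. 0"]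
      by (simp add: L2_def L2_norm_def mult_op_def proj_op_def)
    ultimately have "(op_norm M (mult_op g \<circ> proj_op (Y j)))\<^sup>2 \<le> (sqrt (real j * e))\<^sup>2"
      by (rule power_mono)
    with e show ?thesis by simp
  qed
  have int: "integrable M (\<lambda>x. (cmod (g x))\<^sup>2)"
    by (rule integrable_L_infty_power2[OF g])
  have "M_part M J Y (mult_op g) \<le> (\<Sum>j=1..J. prob (Y j) * (real j * e))"
    unfolding M_part_def by (intro sum_mono mult_left_mono op) auto
  \<comment> \<open>The sum becomes the integral of a step function, which can be compared with
    |g|^2 + e pointwise.\<close>
  also have "\<dots> = (\<Sum>j=1..J. \<integral>x. indicator (Y j) x * (real j * e) \<partial>M)"
    by (intro sum.cong refl) simp
  also have "\<dots> = (\<integral>x. (\<Sum>j=1..J. indicator (Y j) x * (real j * e)) \<partial>M)"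
    by (rule Bochner_Integration.integral_sum[symmetric]) (simp add: less_top[symmetric])
  also have "\<dots> \<le> (\<integral>x. (cmod (g x))\<^sup>2 + e \<partial>M)"
  proof (rule integral_mono_AE')
    show "AE x in M. (\<Sum>j=1..J. indicator (Y j) x * (real j * e)) \<le> (cmod (g x))\<^sup>2 + e"
    proof (rule AE_I2)
      fix x assume "x \<in> space M"
      then have "(\<Sum>j=1..J. indicator (Y j) x * (real j * e))
          = (\<Sum>j=1..J. if j = level x then real j * e else 0)"
        by (intro sum.cong) (auto simp: Y_def indicator_def)
      \<comment> \<open>Only an inequality: on the null set where \<open>level x\<close> exceeds
        \<open>J\<close> no term survives and the sum is 0.\<close>
      also have "\<dots> \<le> real (level x) * e"
        using e by (simp add: sum.delta)
      finally show "(\<Sum>j=1..J. indicator (Y j) x * (real j * e)) \<le> (cmod (g x))\<^sup>2 + e"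
        using level_upper[of x] by simp
    qed
  qed (use int e in auto)
  \<comment> \<open>The total mass is 1, so the constant \<open>e\<close> integrates to
    \<open>e\<close>.\<close>
  also have "\<dots> = (L2_norm M g)\<^sup>2 + e"
    using int by (simp add: L2_norm_def prob_space)
  finally show ?thesis
    using part by blast
qed

end

theorem lemma3p2:
  fixes M :: "'a measure" and g :: "'a \<Rightarrow> complex"
  assumes "prob_space M" and "g \<in> L_infty M"
  shows "mu_norm M (mult_op g) = L2_norm M g"
proof -
  interpret prob_space M by fact
  let ?S = "{sqrt (M_part M J Y (mult_op g)) |J Y. ae_partition M J Y}"
  have nonneg: "0 \<le> L2_norm M g"
    by (simp add: L2_norm_def)
  have lower: "L2_norm M g \<le> s" if "s \<in> ?S" for s
    using that L2_norm_power2_le_M_part[OF assms(2)] by (auto intro: real_le_rsqrt)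
  \<comment> \<open>Any positive tolerance yields a partition, hence an element of the set.\<close>
  have "?S \<noteq> {}"
    using ex_ae_partition_M_part_le[OF assms(2), of 1] by auto
  then have ge: "L2_norm M g \<le> mu_norm M (mult_op g)"
    unfolding mu_norm_def using lower by (rule cInf_greatest)
  \<comment> \<open>The error \<open>e\<close> is additive at the level of squares, so it is sent to
    0 before roots are taken.\<close>
  have "(mu_norm M (mult_op g))\<^sup>2 \<le> (L2_norm M g)\<^sup>2"
  proof (rule field_le_epsilon)
    fix e :: real assume "e > 0"
    then obtain J Y where JY: "ae_partition M J Y"
      and le: "M_part M J Y (mult_op g) \<le> (L2_norm M g)\<^sup>2 + e"
      using ex_ae_partition_M_part_le[OF assms(2)] by blast
    have "mu_norm M (mult_op g) \<le> sqrt (M_part M J Y (mult_op g))"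
      unfolding mu_norm_def using JY lower by (intro cInf_lower bdd_belowI) auto
    also have "\<dots> \<le> sqrt ((L2_norm M g)\<^sup>2 + e)"
      using le by simp
    \<comment> \<open>The lower bound \<open>ge\<close> also shows that \<open>mu_norm\<close> is
      nonnegative, as squaring requires.\<close>
    finally have "(mu_norm M (mult_op g))\<^sup>2 \<le> (sqrt ((L2_norm M g)\<^sup>2 + e))\<^sup>2"
      using ge nonneg by (intro power_mono) auto
    with \<open>e > 0\<close> show "(mu_norm M (mult_op g))\<^sup>2 \<le> (L2_norm M g)\<^sup>2 + e"
      by simp
  qed
  with nonneg have "mu_norm M (mult_op g) \<le> L2_norm M g"
    by (rule power2_le_imp_le[rotated])
  with ge show ?thesis by simp
qed

end
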